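(* Let $x \ge 2$ be real, let $n \ge 1$, and let $h_1, \ldots, h_n > 0$ be growth rates with $\sum_{i=1}^n h_i = 1$. Run the bamboo trimming process (all heights start at $0$; in each time step each bamboo $b_i$ grows by $h_i$, then at most one bamboo is cut to height $0$) with the algorithm Reduce-Fastest$(x)$. Then no bamboo ever attains height $x+1$ (at any time, including immediately after growth and before the cut); in particular the backlog is strictly less than $x+1$.
   Context: Reduce-Fastest$(x)$: in each time step, after the growth phase, among the bamboo whose current height is at least $x$, the algorithm cuts one with the largest growth rate (ties broken arbitrarily) back to height $0$; if no bamboo has height at least $x$, no bamboo is cut in that step. The backlog is the maximum height ever reached by any bamboo. *)

theory Defs
  imports Complex_Main
begin

text \<open>
  Bamboos are the indices in \<open>{1..n}\<close> and \<open>h i\<close> is the growth rate of bamboo \<open>i\<close>.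
  The cuts made are recorded in \<open>c\<close>: in time step \<open>t\<close> (counted from 0) bamboo \<open>j\<close> is cut
  if \<open>c t = Some j\<close>, and no bamboo is cut if \<open>c t = None\<close>.
  \<open>height h c t i\<close> is the height of bamboo \<open>i\<close> after \<open>t\<close> complete time steps, and
  \<open>grown h c t i\<close> its height in time step \<open>t\<close> after the growth and before the cut.
\<close>

fun height :: "(nat \<Rightarrow> real) \<Rightarrow> (nat \<Rightarrow> nat option) \<Rightarrow> nat \<Rightarrow> nat \<Rightarrow> real" where
  "height h c 0 i = 0"
| "height h c (Suc t) i = (if c t = Some i then 0 else height h c t i + h i)"

definition grown :: "(nat \<Rightarrow> real) \<Rightarrow> (nat \<Rightarrow> nat option) \<Rightarrow> nat \<Rightarrow> nat \<Rightarrow> real" where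
  "grown h c t i = height h c t i + h i"

text \<open>
  The choices \<open>d\<close> that Reduce-Fastest allows with threshold \<open>x\<close> when the heights after the
  growth are \<open>g\<close>. As ties are broken arbitrarily, this is a relation.
\<close>

definition reduce_fastest_choice ::
    "real \<Rightarrow> nat \<Rightarrow> (nat \<Rightarrow> real) \<Rightarrow> (nat \<Rightarrow> real) \<Rightarrow> nat option \<Rightarrow> bool" where
  "reduce_fastest_choice x n h g d \<longleftrightarrow>
    (case d of
       None \<Rightarrow> \<forall>i\<in>{1..n}. g i < x
     | Some j \<Rightarrow> j \<in> {1..n} \<and> g j \<ge> x \<and> (\<forall>i\<in>{1..n}. g i \<ge> x \<longrightarrow> h i \<le> h j))"

definition reduce_fastest_run ::
    "real \<Rightarrow> nat \<Rightarrow> (nat \<Rightarrow> real) \<Rightarrow> (nat \<Rightarrow> nat option) \<Rightarrow> bool" where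
  "reduce_fastest_run x n h c \<longleftrightarrow> (\<forall>t. reduce_fastest_choice x n h (grown h c t) (c t))"

definition reached_heights :: "nat \<Rightarrow> (nat \<Rightarrow> real) \<Rightarrow> (nat \<Rightarrow> nat option) \<Rightarrow> real set" where
  "reached_heights n h c =
    {height h c t i | t i. i \<in> {1..n}} \<union> {grown h c t i | t i. i \<in> {1..n}}"

text \<open>
  The backlog is a maximum over infinitely many time steps. It is given as a predicate, since a
  run without a maximal height has no backlog; it is unique if it exists.
\<close>

definition is_backlog :: "nat \<Rightarrow> (nat \<Rightarrow> real) \<Rightarrow> (nat \<Rightarrow> nat option) \<Rightarrow> real \<Rightarrow> bool" where
  "is_backlog n h c B \<longleftrightarrow>
    B \<in> reached_heights n h c \<and> (\<forall>y\<in>reached_heights n h c. y \<le> B)"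

end

(* Suppose bamboo b_k reaches x + 1, for the first time at T, and let t0 be the start of the last
   stretch of L = T - t0 steps during which it is at least x; then 1/h_k - 1 < L and
   (L - 1) h_k < 1. Each of these L steps cuts some other bamboo b_j with h_j >= h_k. If b_j is
   cut m >= 2 times, it regrows to x at least m - 1 times within L - 1 steps, so
   m <= 2 (m - 1) <= x (m - 1) <= (L - 1) h_j <= h_j / h_k; for m <= 1 the bound m <= h_j / h_k
   is clear. Summing over j gives L <= (1 - h_k) / h_k = 1/h_k - 1, a contradiction.
   Heights of b_i are multiples of h_i, so only finitely many are reached and a maximum exists. *)
theory Submission
  imports Defs
begin

lemma height_nonneg: "h i \<ge> 0 \<Longrightarrow> height h c t i \<ge> 0"
  by (induction t) auto

text \<open>Growth adds \<open>h i\<close> and a cut resets to 0, so the heights of one bamboo form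
  a discrete set. This is what makes the backlog an attained maximum.\<close>

lemma height_multiple: "\<exists>m::nat. height h c t i = real m * h i"
proof (induction t)
  case 0
  show ?case by (rule exI[of _ 0]) simp
next
  case (Suc t)
  then obtain m where m: "height h c t i = real m * h i" by blast
  show ?case
  proof (cases "c t = Some i")
    case True
    then show ?thesis by (intro exI[of _ 0]) simp
  next
    case False
    then show ?thesis using m by (intro exI[of _ "Suc m"]) (simp add: algebra_simps)
  qed
qed

lemma grown_multiple: "\<exists>m::nat. grown h c t i = real m * h i"
proof -
  obtain m where "height h c t i = real m * h i" using height_multiple by blast
  then show ?thesis
    unfolding grown_def by (intro exI[of _ "Suc m"]) (simp add: algebra_simps)
qed

lemma grown_Suc: "grown h c (Suc t) i = (if c t = Some i then h i else grown h c t i + h i)"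
  by (simp add: grown_def)

lemma grown_add_uncut:
  assumes "\<And>s. a \<le> s \<Longrightarrow> s < a + l \<Longrightarrow> c s \<noteq> Some i"
  shows "grown h c (a + l) i = grown h c a i + real l * h i"
  using assms by (induction l) (auto simp: grown_Suc algebra_simps)

lemma reduce_fastest_run_cut:
  assumes "reduce_fastest_run x n h c" "c t = Some j"
  shows "j \<in> {1..n}" "grown h c t j \<ge> x"
    and "\<And>i. i \<in> {1..n} \<Longrightarrow> grown h c t i \<ge> x \<Longrightarrow> h i \<le> h j"
  using assms unfolding reduce_fastest_run_def reduce_fastest_choice_def
  by (auto dest!: spec[of _ t])

lemma reduce_fastest_run_cuts:
  assumes "reduce_fastest_run x n h c" "i \<in> {1..n}" "grown h c t i \<ge> x"
  obtains j where "c t = Some j"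
proof (cases "c t")
  case None
  then have "grown h c t i < x"
    using assms(1,2) unfolding reduce_fastest_run_def reduce_fastest_choice_def
    by (auto dest!: spec[of _ t])
  then show ?thesis using assms(3) by simp
qed

definition cuts :: "(nat \<Rightarrow> nat option) \<Rightarrow> nat \<Rightarrow> nat \<Rightarrow> nat \<Rightarrow> nat set" where
  "cuts c j a b = {s \<in> {a..<b}. c s = Some j}"

text \<open>Balance for bamboo \<open>j\<close> over \<open>l\<close> steps: growth adds
  \<open>l * h j\<close> in total, and every cut removes at least \<open>x\<close>, since
  Reduce-Fastest cuts only at height at least \<open>x\<close>.\<close>

lemma cuts_volume:
  assumes "reduce_fastest_run x n h c"
  shows "real (card (cuts c j a (a + l))) * x + height h c (a + l) j
    \<le> height h c a j + real l * h j"
proof (induction l)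
  case 0
  show ?case by (simp add: cuts_def)
next
  case (Suc l)
  show ?case
  proof (cases "c (a + l) = Some j")
    case True
    have "cuts c j a (a + Suc l) = insert (a + l) (cuts c j a (a + l))"
      using True by (auto simp: cuts_def less_Suc_eq)
    moreover have "a + l \<notin> cuts c j a (a + l)" "finite (cuts c j a (a + l))"
      by (auto simp: cuts_def)
    ultimately have "card (cuts c j a (a + Suc l)) = Suc (card (cuts c j a (a + l)))"
      by simp
    moreover have "height h c (a + l) j + h j \<ge> x"
      using reduce_fastest_run_cut(2)[OF assms True] by (simp add: grown_def)
    ultimately show ?thesis using Suc True by (simp add: algebra_simps)
  next
    case False
    then have "cuts c j a (a + Suc l) = cuts c j a (a + l)"
      by (auto simp: cuts_def less_Suc_eq)
    then show ?thesis using Suc False by (simp add: algebra_simps)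
  qed
qed

text \<open>The first cut in the window leaves height 0, so applying the balance only after it
  removes the initial height, at the price of one cut. The first cut itself takes one step, hence
  \<open>l - 1\<close> on the right.\<close>

lemma card_cuts_le:
  assumes run: "reduce_fastest_run x n h c" and h: "h j \<ge> 0"
    and ne: "cuts c j a (a + l) \<noteq> {}"
  shows "(real (card (cuts c j a (a + l))) - 1) * x \<le> (real l - 1) * h j"
proof -
  define s where "s = Min (cuts c j a (a + l))"
  have fin: "finite (cuts c j a (a + l))" by (simp add: cuts_def)
  have s: "s \<in> cuts c j a (a + l)" using Min_in[OF fin ne] by (simp add: s_def)
  then have cs: "c s = Some j" "a \<le> s" "s < a + l" by (auto simp: cuts_def)
  have min: "s \<le> r" if "r \<in> cuts c j a (a + l)" for r
    using that fin by (simp add: s_def)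
  define l' where "l' = a + l - Suc s"
  have l': "Suc s + l' = a + l" using cs by (simp add: l'_def)
  have "cuts c j a (a + l) = insert s (cuts c j (Suc s) (a + l))"
  proof
    show "cuts c j a (a + l) \<subseteq> insert s (cuts c j (Suc s) (a + l))"
      using min by (auto simp: cuts_def Suc_le_eq nat_less_le)
    show "insert s (cuts c j (Suc s) (a + l)) \<subseteq> cuts c j a (a + l)"
      using cs by (auto simp: cuts_def)
  qed
  moreover have "s \<notin> cuts c j (Suc s) (a + l)" "finite (cuts c j (Suc s) (a + l))"
    by (auto simp: cuts_def)
  ultimately have "card (cuts c j a (a + l)) = Suc (card (cuts c j (Suc s) (a + l)))"
    by simp
  moreover have "real (card (cuts c j (Suc s) (a + l))) * x \<le> real l' * h j"
    using cuts_volume[OF run, of j "Suc s" l'] cs height_nonneg[of h j c "a + l"] h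
    by (simp add: l' del: add_Suc)
  moreover have "real l' * h j \<le> (real l - 1) * h j"
    using l' cs h by (intro mult_right_mono) linarith+
  ultimately show ?thesis by simp
qed

lemma reduce_fastest_grown_less:
  assumes x: "x \<ge> 2" and pos: "\<And>i. i \<in> {1..n} \<Longrightarrow> h i > 0"
    and sum: "(\<Sum>i=1..n. h i) = 1" and run: "reduce_fastest_run x n h c"
    and k: "k \<in> {1..n}"
  shows "grown h c t k < x + 1"
proof (rule ccontr)
  assume "\<not> grown h c t k < x + 1"
  then have ex: "grown h c t k \<ge> x + 1" by simp
  define T where "T = (LEAST T. grown h c T k \<ge> x + 1)"
  have T: "grown h c T k \<ge> x + 1" unfolding T_def by (rule LeastI[of _ t]) (rule ex)
  have T_min: "grown h c s k < x + 1" if "s < T" for s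
    using not_less_Least[OF that[unfolded T_def]] by simp
  have hk: "h k > 0" using pos k by blast
  have "h k \<le> sum h {1..n}"
    by (rule member_le_sum[OF k]) (use pos in \<open>auto intro: less_imp_le\<close>)
  then have hk1: "h k \<le> 1" using sum by simp
  \<comment> \<open>The least \<open>a\<close> with \<open>P a\<close> starts the maximal stretch up
    to \<open>T\<close> on which \<open>k\<close> stays at height at least \<open>x\<close>. As
    \<open>P\<close> holds vacuously beyond \<open>T\<close>, it is \<open>P T\<close> that ensures
    \<open>a \<le> T\<close>.\<close>
  define P where "P a \<longleftrightarrow> (\<forall>s. a \<le> s \<longrightarrow> s \<le> T \<longrightarrow> grown h c s k \<ge> x)" for a
  define a where "a = (LEAST a. P a)"
  have "P T" using T by (auto simp: P_def)
  then have a: "P a" "a \<le> T" unfolding a_def by (auto intro: LeastI Least_le)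
  have tall: "grown h c s k \<ge> x" if "a \<le> s" "s \<le> T" for s
    using a that by (simp add: P_def)
  \<comment> \<open>Unless the stretch starts at time 0, maximality puts \<open>k\<close> below
    \<open>x\<close> one step earlier, and one step adds at most \<open>h k\<close>.\<close>
  have start: "grown h c a k < x + h k"
  proof (cases a)
    case 0
    then show ?thesis using x by (simp add: grown_def)
  next
    case (Suc b)
    then have "\<not> P b" using not_less_Least[of b P] by (simp add: a_def)
    then obtain s where "b \<le> s" "s \<le> T" "grown h c s k < x" by (auto simp: P_def not_le)
    moreover from this have "\<not> a \<le> s" using tall[of s] by auto
    ultimately have "grown h c b k < x" using Suc by (simp add: not_le less_Suc_eq_le)
    then show ?thesis using Suc hk x by (auto simp: grown_Suc)
  qed
  define L where "L = T - a"
  have TL: "T = a + L" using a by (simp add: L_def)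
  \<comment> \<open>After a cut, \<open>k\<close> would have height \<open>h k \<le> 1 < x\<close>
    in the next step, which still belongs to the stretch because \<open>s < T\<close>.\<close>
  have uncut: "c s \<noteq> Some k" if "a \<le> s" "s < a + L" for s
  proof
    assume "c s = Some k"
    then have "grown h c (Suc s) k = h k" by (simp add: grown_Suc)
    moreover have "grown h c (Suc s) k \<ge> x" using tall that TL by simp
    ultimately show False using hk1 x by simp
  qed
  have grow: "grown h c (a + l) k = grown h c a k + real l * h k" if "l \<le> L" for l
    using that uncut by (intro grown_add_uncut) auto
  \<comment> \<open>From below \<open>x + h k\<close>, the bamboo must climb to \<open>x + 1\<close>
    in \<open>L\<close> uncut steps.\<close>
  have L_lower: "1 < (real L + 1) * h k"
    using grow[of L] T start by (simp add: TL algebra_simps)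
  then have "L > 0" using hk1 by (cases L) auto
  then obtain l where l: "L = Suc l" by (cases L) auto
  \<comment> \<open>At time \<open>T - 1 = a + l\<close> the height is still below
    \<open>x + 1\<close> since \<open>T\<close> is the first violation, while at \<open>a\<close> it
    was already at least \<open>x\<close>.\<close>
  have L_upper: "(real L - 1) * h k < 1"
    using grow[of l] T_min[of "a + l"] tall[of a] by (simp add: TL l)
  \<comment> \<open>Throughout the stretch \<open>k\<close> is eligible but never cut, so each step
    cuts another bamboo that is at least as fast.\<close>
  define J where "J = {j \<in> {1..n}. j \<noteq> k \<and> h k \<le> h j}"
  have "{a..<a + L} \<subseteq> (\<Union>j\<in>J. cuts c j a (a + L))"
  proof
    fix s assume s: "s \<in> {a..<a + L}"
    then have sx: "grown h c s k \<ge> x" using tall TL by simp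
    obtain j where j: "c s = Some j" by (rule reduce_fastest_run_cuts[OF run k sx])
    have "j \<in> {1..n}" "h k \<le> h j" "j \<noteq> k"
      using reduce_fastest_run_cut[OF run j] k sx uncut[of s] s j by auto
    then show "s \<in> (\<Union>j\<in>J. cuts c j a (a + L))"
      using s j by (auto simp: J_def cuts_def)
  qed
  then have "card {a..<a + L} \<le> card (\<Union>j\<in>J. cuts c j a (a + L))"
    by (intro card_mono) (auto simp: J_def cuts_def)
  also have "\<dots> \<le> (\<Sum>j\<in>J. card (cuts c j a (a + L)))"
    by (intro card_UN_le) (simp add: J_def)
  finally have "real L \<le> (\<Sum>j\<in>J. real (card (cuts c j a (a + L))))"
    by (simp flip: of_nat_sum)
  then have "real L * h k \<le> (\<Sum>j\<in>J. real (card (cuts c j a (a + L)))) * h k"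
    using hk by (intro mult_right_mono) auto
  also have "\<dots> = (\<Sum>j\<in>J. real (card (cuts c j a (a + L))) * h k)"
    by (simp add: sum_distrib_right)
  also have "\<dots> \<le> (\<Sum>j\<in>J. h j)"
  proof (rule sum_mono)
    fix j assume "j \<in> J"
    then have hj: "h k \<le> h j" by (simp add: J_def)
    define m where "m = card (cuts c j a (a + L))"
    show "real (card (cuts c j a (a + L))) * h k \<le> h j"
    proof (cases "m \<ge> 2")
      case False
      then have "real m * h k \<le> 1 * h k" using hk by (intro mult_right_mono) auto
      then show ?thesis using hj by (simp add: m_def)
    next
      case True
      then have "cuts c j a (a + L) \<noteq> {}" by (auto simp: m_def)
      then have bound: "(real m - 1) * x \<le> (real L - 1) * h j"
        using card_cuts_le[OF run] hj hk by (simp add: m_def)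
      \<comment> \<open>This fails for \<open>m = 1\<close>, hence the case split; the factor 2 is
        where the constant in \<open>x \<ge> 2\<close> comes from.\<close>
      have "real m \<le> (real m - 1) * 2" using True by simp
      also have "\<dots> \<le> (real m - 1) * x" using True x by (intro mult_left_mono) auto
      finally have "real m * h k \<le> ((real L - 1) * h j) * h k"
        using bound hk by (intro mult_right_mono) auto
      also have "\<dots> = ((real L - 1) * h k) * h j" by simp
      also have "\<dots> \<le> 1 * h j" using L_upper hj hk by (intro mult_right_mono) auto
      finally show ?thesis by (simp add: m_def)
    qed
  qed
  \<comment> \<open>Leaving out \<open>k\<close> saves exactly the \<open>h k\<close> needed:
    \<open>L * h k \<le> 1 - h k\<close> contradicts \<open>L_lower\<close>.\<close>
  also have "\<dots> \<le> (\<Sum>j\<in>{1..n} - {k}. h j)"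
    using pos by (intro sum_mono2) (auto simp: J_def intro: less_imp_le)
  also have "\<dots> = 1 - h k" using sum k by (simp add: sum_diff1)
  finally show False using L_lower by (simp add: algebra_simps)
qed

text \<open>Strict bounds on the single heights would still allow a supremum equal to
  \<open>x + 1\<close>. A bound \<open>M\<close> leaves only finitely many multiples of each
  \<open>h i\<close>, so a maximum exists and is itself a reached height.\<close>

lemma finite_reached_heights:
  assumes pos: "\<And>i. i \<in> {1..n} \<Longrightarrow> h i > 0"
    and bound: "\<And>y. y \<in> reached_heights n h c \<Longrightarrow> y \<le> M"
  shows "finite (reached_heights n h c)"
proof -
  define F where "F i = (\<lambda>m::nat. real m * h i) ` {..nat \<lceil>M / h i\<rceil>}" for i
  have "y \<in> (\<Union>i\<in>{1..n}. F i)" if y: "y \<in> reached_heights n h c" for y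
  proof -
    obtain t i where i: "i \<in> {1..n}" and "y = height h c t i \<or> y = grown h c t i"
      using y unfolding reached_heights_def by blast
    then obtain m where m: "y = real m * h i"
      using height_multiple[of h c t i] grown_multiple[of h c t i] by metis
    have "real m \<le> M / h i"
      using bound[OF y] pos[OF i] m by (simp add: pos_le_divide_eq)
    then have "m \<le> nat \<lceil>M / h i\<rceil>" by linarith
    then show ?thesis using i m by (auto simp: F_def)
  qed
  then have "reached_heights n h c \<subseteq> (\<Union>i\<in>{1..n}. F i)" by blast
  moreover have "finite (\<Union>i\<in>{1..n}. F i)" by (simp add: F_def)
  ultimately show ?thesis by (rule finite_subset)
qed

theorem theorem3p1:
  fixes x :: real and n :: nat and h :: "nat \<Rightarrow> real" and c :: "nat \<Rightarrow> nat option"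
  assumes "x \<ge> 2"
    and "n \<ge> 1"
    and "\<And>i. i \<in> {1..n} \<Longrightarrow> h i > 0"
    and "(\<Sum>i=1..n. h i) = 1"
    and "reduce_fastest_run x n h c"
  shows "(\<forall>t. \<forall>i\<in>{1..n}. height h c t i < x + 1 \<and> grown h c t i < x + 1) \<and>
    (\<exists>B. is_backlog n h c B \<and> B < x + 1)"
proof -
  let ?R = "reached_heights n h c"
  have g: "grown h c t i < x + 1" if "i \<in> {1..n}" for t i
    using reduce_fastest_grown_less[OF assms(1) _ assms(4,5) that] assms(3) by blast
  have hg: "height h c t i < x + 1" if "i \<in> {1..n}" for t i
    using g[OF that, of t] assms(3)[OF that] by (simp add: grown_def)
  have less: "y < x + 1" if "y \<in> ?R" for y
    using that g hg by (auto simp: reached_heights_def)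
  have fin: "finite ?R"
    using assms(3) less by (intro finite_reached_heights[where M = "x + 1"]) (auto intro: less_imp_le)
  have ne: "?R \<noteq> {}"
    using assms(2) by (auto simp: reached_heights_def)
  have "is_backlog n h c (Max ?R)"
    using fin ne by (simp add: is_backlog_def)
  moreover have "Max ?R < x + 1" using less Max_in[OF fin ne] by blast
  ultimately show ?thesis using g hg by blast
qed

end
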